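(* Let $N\ge1$ be an integer, $k=(k_1,\dots,k_N)\in\mathbb R_{>0}^N$ and $0<c<1$. The operators $L^{\mathrm{SIP}}$ and $L^{\mathrm{BEP}}$ are in duality, with duality function $$D(n,x)=\prod_{j=1}^N L(n_j,x_j;k_j),\qquad n\in\mathbb N^N,\ x\in\mathbb R_{>0}^N,$$ i.e. $[L^{\mathrm{SIP}}D(\cdot,x)](n)=[L^{\mathrm{BEP}}D(n,\cdot)](x)$ for all $n\in\mathbb N^N$, $x\in\mathbb R_{>0}^N$.
   Context: $\mathbb N$ is the set of nonnegative integers. For $f:\mathbb N^N\to\mathbb C$, $$L^{\mathrm{SIP}}f(n)=\sum_{1\le i<j\le N}\Big[n_i(2k_j+n_j)\big(f(n^{i,j})-f(n)\big)+n_j(2k_i+n_i)\big(f(n^{j,i})-f(n)\big)\Big],$$ where $n^{i,j}=n-e_i+e_j$ with $e_i$ the $i$-th standard basis vector (a term with prefactor $n_i=0$ is zero); this generates the symmetric inclusion process SIP($k$). For smooth functions $f$ on $\mathbb R_{>0}^N$, $$L^{\mathrm{BEP}}f(x)=\sum_{1\le i<j\le N}\left[x_ix_j\left(\frac{\partial}{\partial x_i}-\frac{\partial}{\partial x_j}\right)^2f(x)-2(k_jx_i-k_ix_j)\left(\frac{\partial}{\partial x_i}-\frac{\partial}{\partial x_j}\right)f(x)\right];$$ this generates the Brownian energy process BEP($k$). The Laguerre polynomials are $L_n^{(\alpha)}(x)=\frac{(\alpha+1)_n}{n!}\sum_{m=0}^n\frac{(-n)_m}{(\alpha+1)_m\,m!}x^m$,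 where $(a)_m=a(a+1)\cdots(a+m-1)$, $(a)_0=1$, and, with $c$ a fixed parameter, $$L(n,x;k)=\frac{n!\,c^{-n/2}}{(2k)_n}L_n^{(2k-1)}(x).$$ *)

theory Defs
  imports "HOL-Analysis.Analysis"
begin

text \<open>
  The sites \<open>1, \<dots>, N\<close> are the elements of a finite linearly ordered index type \<open>'N\<close>
  with \<open>N = CARD('N) \<ge> 1\<close>, so that \<open>\<nat>\<^sup>N\<close> is \<open>nat ^ 'N\<close> and \<open>\<real>\<^sup>N\<close> is \<open>real ^ 'N\<close>.
\<close>

text \<open>
  The subtraction on \<open>nat\<close> is truncated, so \<open>move i j n\<close> is the configuration \<open>n - e\<^sub>i + e\<^sub>j\<close>
  only if \<open>n $ i > 0\<close>. In the generator it comes with the prefactor \<open>n $ i\<close>.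
\<close>

definition move :: "'N \<Rightarrow> 'N \<Rightarrow> nat ^ 'N \<Rightarrow> nat ^ 'N::finite" where
  "move i j n = n - axis i 1 + axis j 1"

definition SIP_gen ::
    "real ^ 'N::{finite,linorder} \<Rightarrow> (nat ^ 'N::{finite,linorder} \<Rightarrow> complex) \<Rightarrow>
      nat ^ 'N::{finite,linorder} \<Rightarrow> complex" where
  "SIP_gen k f n = (\<Sum>(i, j) \<in> {(i, j). i < j}.
      (real (n $ i) * (2 * k $ j + real (n $ j))) *\<^sub>R (f (move i j n) - f n)
    + (real (n $ j) * (2 * k $ i + real (n $ i))) *\<^sub>R (f (move j i n) - f n))"

definition partial_deriv :: "'N \<Rightarrow> (real ^ 'N \<Rightarrow> complex) \<Rightarrow> real ^ 'N::finite \<Rightarrow> complex" where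
  "partial_deriv i f x = vector_derivative (\<lambda>t. f (x + t *\<^sub>R axis i 1)) (at 0)"

definition diff_deriv ::
    "'N \<Rightarrow> 'N \<Rightarrow> (real ^ 'N \<Rightarrow> complex) \<Rightarrow> real ^ 'N::finite \<Rightarrow> complex" where
  "diff_deriv i j f = (\<lambda>x. partial_deriv i f x - partial_deriv j f x)"

text \<open>
  The value at \<open>x\<close> depends only on \<open>f\<close> near \<open>x\<close>, so a function on the open positive orthant may be
  given by any extension to \<open>real ^ 'N\<close>.
\<close>

definition BEP_gen ::
    "real ^ 'N::{finite,linorder} \<Rightarrow> (real ^ 'N::{finite,linorder} \<Rightarrow> complex) \<Rightarrow>
      real ^ 'N::{finite,linorder} \<Rightarrow> complex" where
  "BEP_gen k f x = (\<Sum>(i, j) \<in> {(i, j). i < j}.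
      (x $ i * x $ j) *\<^sub>R (diff_deriv i j ^^ 2) f x
    - (2 * (k $ j * x $ i - k $ i * x $ j)) *\<^sub>R diff_deriv i j f x)"

definition laguerre :: "nat \<Rightarrow> real \<Rightarrow> real \<Rightarrow> real" where
  "laguerre n \<alpha> x = pochhammer (\<alpha> + 1) n / fact n *
     (\<Sum>m = 0..n. pochhammer (- real n) m / (pochhammer (\<alpha> + 1) m * fact m) * x ^ m)"

definition normalized_laguerre :: "real \<Rightarrow> nat \<Rightarrow> real \<Rightarrow> real \<Rightarrow> real" where
  "normalized_laguerre c n x \<kappa> =
     fact n * c powr (- real n / 2) / pochhammer (2 * \<kappa>) n * laguerre n (2 * \<kappa> - 1) x"

definition duality_fun ::
    "real \<Rightarrow> real ^ 'N \<Rightarrow> nat ^ 'N \<Rightarrow> real ^ 'N::finite \<Rightarrow> complex" where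
  "duality_fun c k n x = complex_of_real (\<Prod>j\<in>UNIV. normalized_laguerre c (n $ j) (x $ j) (k $ j))"

end

theory Submission
  imports Defs "HOL-Computational_Algebra.Polynomial"
begin

text \<open>
  Up to the factor \<open>c\<^sup>-\<^sup>n\<^sup>/\<^sup>2\<close>, the one-site functions are the confluent hypergeometric polynomials
  \<open>p\<^sub>n(x) = \<^sub>1F\<^sub>1(-n; 2k; x)\<close>, and SIP preserves the total particle number, so these factors cancel.
  The Laguerre differential equation removes the second derivatives from the BEP generator acting on
  \<open>p\<^sub>n(x\<^sub>i) p\<^sub>m(x\<^sub>j)\<close>; the lowering relation \<open>x p\<^sub>n' = n (p\<^sub>n - p\<^sub>n\<^sub>-\<^sub>1)\<close> removes the first ones, and the
  three-term recurrence turns the remaining multiplications by \<open>x\<^sub>i\<close>, \<open>x\<^sub>j\<close> into shifts of \<open>n\<close>, \<open>m\<close>.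
  What is left is the SIP generator, edge by edge.
\<close>

section \<open>One-site polynomials and their relations\<close>

definition kummer_poly :: "real \<Rightarrow> nat \<Rightarrow> real poly" where
  "kummer_poly b n =
     (\<Sum>m\<le>n. monom (pochhammer (- real n) m / (pochhammer b m * fact m)) m)"

text \<open>For \<open>m > n\<close> the Pochhammer symbol of \<open>- n\<close> contains the factor
  0. No bound on \<open>m\<close> is needed, so identities can be compared coefficientwise.\<close>

lemma coeff_kummer_poly:
  "coeff (kummer_poly b n) m = pochhammer (- real n) m / (pochhammer b m * fact m)"
  by (auto simp: kummer_poly_def coeff_sum pochhammer_of_nat_eq_0_iff)

lemma coeff_kummer_poly_Suc:
  "coeff (kummer_poly b n) (Suc m) =
     coeff (kummer_poly b n) m * ((real m - real n) / ((b + real m) * (real m + 1)))"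
  by (simp add: coeff_kummer_poly pochhammer_Suc algebra_simps)

lemma coeff_kummer_poly_0 [simp]: "coeff (kummer_poly b n) 0 = 1"
  by (simp add: coeff_kummer_poly)

text \<open>Split \<open>pochhammer (- n) (m + 1)\<close> at its first and at its last factor. For
  \<open>n = 0\<close>, where \<open>n - 1\<close> is truncated, both sides vanish.\<close>

lemma coeff_kummer_poly_lower:
  "real n * coeff (kummer_poly b (n - 1)) m = (real n - real m) * coeff (kummer_poly b n) m"
proof (cases n)
  case 0
  then show ?thesis by (cases m) (auto simp: coeff_kummer_poly pochhammer_0_left)
next
  case (Suc r)
  have "pochhammer (- real n) (Suc m) = - real n * pochhammer (- real r) m"
    by (simp add: pochhammer_rec Suc)
  then have "real n * pochhammer (- real r) m = (real n - real m) * pochhammer (- real n) m"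
    by (simp add: pochhammer_Suc algebra_simps)
  then show ?thesis by (simp add: Suc coeff_kummer_poly)
qed

text \<open>\<open>pCons 0\<close> is multiplication by \<open>x\<close>, so \<open>x\<close> times
  the derivative scales the coefficient of degree \<open>m\<close> by \<open>m\<close>; the
  coefficient relation above gives the rest.\<close>

lemma kummer_poly_lower:
  "x * poly (pderiv (kummer_poly b n)) x =
     real n * (poly (kummer_poly b n) x - poly (kummer_poly b (n - 1)) x)"
proof -
  have "pCons 0 (pderiv (kummer_poly b n)) =
      smult (real n) (kummer_poly b n - kummer_poly b (n - 1))"
  proof (rule poly_eqI)
    fix m
    show "coeff (pCons 0 (pderiv (kummer_poly b n))) m =
        coeff (smult (real n) (kummer_poly b n - kummer_poly b (n - 1))) m"
      using coeff_kummer_poly_lower[of n b m]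
      by (cases m) (simp_all add: coeff_pCons coeff_pderiv algebra_simps)
  qed
  from arg_cong[OF this, of "\<lambda>p. poly p x"] show ?thesis by simp
qed

text \<open>Kummer's equation: in each degree it is the ratio of consecutive hypergeometric
  coefficients, with \<open>b > 0\<close> keeping \<open>b + m\<close> nonzero.\<close>

lemma kummer_poly_ode:
  assumes "b > 0"
  shows "x * poly (pderiv (pderiv (kummer_poly b n))) x + b * poly (pderiv (kummer_poly b n)) x =
    x * poly (pderiv (kummer_poly b n)) x - real n * poly (kummer_poly b n) x"
proof -
  let ?p = "kummer_poly b n"
  have "pCons 0 (pderiv (pderiv ?p)) + smult b (pderiv ?p) =
      pCons 0 (pderiv ?p) - smult (real n) ?p"
  proof (rule poly_eqI)
    fix m
    have "(b + real m) * (real m + 1) * coeff ?p (Suc m) = (real m - real n) * coeff ?p m"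
      using assms by (simp add: coeff_kummer_poly_Suc add_pos_nonneg)
    then show "coeff (pCons 0 (pderiv (pderiv ?p)) + smult b (pderiv ?p)) m =
        coeff (pCons 0 (pderiv ?p) - smult (real n) ?p) m"
      by (cases m) (simp_all add: coeff_pCons coeff_pderiv algebra_simps)
  qed
  from arg_cong[OF this, of "\<lambda>p. poly p x"] show ?thesis by simp
qed

lemma kummer_poly_recurrence:
  assumes "b > 0"
  shows "x * poly (kummer_poly b n) x = (b + 2 * real n) * poly (kummer_poly b n) x
    - real n * poly (kummer_poly b (n - 1)) x - (b + real n) * poly (kummer_poly b (Suc n)) x"
proof -
  have "pCons 0 (kummer_poly b n) = smult (b + 2 * real n) (kummer_poly b n)
      - smult (real n) (kummer_poly b (n - 1)) - smult (b + real n) (kummer_poly b (Suc n))"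
  proof (rule poly_eqI)
    fix m
    show "coeff (pCons 0 (kummer_poly b n)) m = coeff (smult (b + 2 * real n) (kummer_poly b n)
      - smult (real n) (kummer_poly b (n - 1)) - smult (b + real n) (kummer_poly b (Suc n))) m"
    proof (cases m)
      case 0
      then show ?thesis by simp
    next
      case (Suc r)
      \<comment> \<open>All coefficients of degree \<open>m = r + 1\<close> become multiples of
        \<open>t / d\<close>.\<close>
      define t d where "t = coeff (kummer_poly b n) r" and "d = (b + real r) * (real r + 1)"
      have d: "d \<noteq> 0" using assms by (simp add: d_def add_pos_nonneg)
      have mid: "coeff (kummer_poly b n) m = t * (real r - real n) / d"
        by (simp add: Suc coeff_kummer_poly_Suc t_def d_def)
      have low: "real n * coeff (kummer_poly b (n - 1)) m =
          (real n - real m) * (t * (real r - real n) / d)"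
        using coeff_kummer_poly_lower[of n b m] mid by simp
      have up: "coeff (kummer_poly b (Suc n)) m = - (real n + 1) * t / d"
        using pochhammer_rec[of "- real (Suc n)" r]
        by (simp add: Suc coeff_kummer_poly pochhammer_Suc[of b] t_def d_def algebra_simps)
      \<comment> \<open>Up to the factor \<open>t\<close>, this is \<open>(r - n) * (b + n + r + 1)
        + (b + n) * (n + 1) = (r + 1) * (b + r)\<close>.\<close>
      have "t = ((b + 2 * real n) * (t * (real r - real n))
          - (real n - real m) * (t * (real r - real n)) - (b + real n) * ((- real n - 1) * t)) / d"
        using d by (simp add: field_simps) (simp add: d_def Suc algebra_simps)
      then show ?thesis
        using low mid up
        by (simp add: Suc t_def[symmetric] diff_divide_distrib add_divide_distrib)
    qed
  qed
  from arg_cong[OF this, of "\<lambda>p. poly p x"] show ?thesis by simp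
qed

text \<open>With \<alpha> + 1 = 2 \<kappa> the normalization cancels the Laguerre prefactor. A
  natural power of \<open>c powr (- 1 / 2)\<close> lets exponents of different sites be
  added.\<close>

lemma normalized_laguerre_eq_kummer_poly:
  assumes "\<kappa> > 0" "c > 0"
  shows "normalized_laguerre c n x \<kappa> = (c powr (- 1 / 2)) ^ n * poly (kummer_poly (2 * \<kappa>) n) x"
proof -
  have "pochhammer (2 * \<kappa>) n \<noteq> 0"
    using assms pochhammer_pos[of "2 * \<kappa>" n] by simp
  moreover have "c powr (- real n / 2) = (c powr (- 1 / 2)) ^ n"
    using assms by (simp add: powr_realpow[symmetric] powr_powr)
  ultimately show ?thesis
    by (simp add: normalized_laguerre_def laguerre_def kummer_poly_def poly_sum poly_monom
        atLeast0AtMost)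
qed

section \<open>Derivatives of products of one-site polynomials\<close>

definition poly_prod :: "('N \<Rightarrow> real poly) \<Rightarrow> real ^ 'N::finite \<Rightarrow> complex" where
  "poly_prod q x = complex_of_real (\<Prod>l\<in>UNIV. poly (q l) (x $ l))"

lemma duality_fun_eq_poly_prod:
  assumes "\<And>j. k $ j > 0" "c > 0"
  shows "duality_fun c k n =
    poly_prod (\<lambda>l. smult ((c powr (- 1 / 2)) ^ (n $ l)) (kummer_poly (2 * k $ l) (n $ l)))"
  using assms by (simp add: fun_eq_iff duality_fun_def poly_prod_def normalized_laguerre_eq_kummer_poly)

lemma prod_remove2:
  fixes f :: "'a::finite \<Rightarrow> 'b::comm_monoid_mult"
  assumes "i \<noteq> j"
  shows "prod f UNIV = f i * f j * prod f (UNIV - {i, j})"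
proof -
  have "UNIV - {i} - {j} = UNIV - {i, j}" by auto
  then show ?thesis
    using assms prod.remove[of UNIV i f] prod.remove[of "UNIV - {i}" j f] by (simp add: ac_simps)
qed

lemma poly_prod_remove2:
  assumes "i \<noteq> j"
  shows "poly_prod q x = complex_of_real (poly (q i) (x $ i) * poly (q j) (x $ j) *
    (\<Prod>l\<in>UNIV - {i, j}. poly (q l) (x $ l)))"
  unfolding poly_prod_def by (subst prod_remove2[OF assms]) simp

text \<open>Along axis \<open>i\<close> only one factor varies, so differentiation stays within the
  class of such products.\<close>

lemma has_vector_derivative_poly_prod:
  "((\<lambda>t. poly_prod q (x + t *\<^sub>R axis i 1)) has_vector_derivative
     poly_prod (q(i := pderiv (q i))) x) (at 0)"
proof -
  let ?R = "\<Prod>l\<in>UNIV - {i}. poly (q l) (x $ l)"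
  have 1: "poly_prod q (x + t *\<^sub>R axis i 1) = complex_of_real (poly (q i) (x $ i + t) * ?R)" for t
    unfolding poly_prod_def
    by (subst prod.remove[of UNIV i]) (auto simp: axis_def intro!: prod.cong)
  have 2: "poly_prod (q(i := pderiv (q i))) x = complex_of_real (poly (pderiv (q i)) (x $ i) * ?R)"
    unfolding poly_prod_def
    by (subst prod.remove[of UNIV i]) (auto intro!: prod.cong)
  have "((\<lambda>t. poly (q i) (x $ i + t) * ?R) has_field_derivative
      poly (pderiv (q i)) (x $ i) * ?R) (at 0)"
    by (auto intro!: derivative_eq_intros DERIV_chain2[OF poly_DERIV])
  then have "((\<lambda>t. poly (q i) (x $ i + t) * ?R) has_vector_derivative
      poly (pderiv (q i)) (x $ i) * ?R) (at 0)"
    by (simp add: has_real_derivative_iff_has_vector_derivative)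
  then show ?thesis
    unfolding 1 2 by (rule bounded_linear.has_vector_derivative[OF bounded_linear_of_real])
qed

lemma partial_deriv_poly_prod:
  "partial_deriv i (poly_prod q) = poly_prod (q(i := pderiv (q i)))"
  using has_vector_derivative_poly_prod
  by (auto simp: fun_eq_iff partial_deriv_def intro!: vector_derivative_at)

text \<open>\<open>diff_deriv\<close> turns a product into a difference of two products; this allows
  applying it a second time.\<close>

lemma partial_deriv_diff_poly_prod:
  "partial_deriv i (\<lambda>x. poly_prod p x - poly_prod q x) =
     (\<lambda>x. partial_deriv i (poly_prod p) x - partial_deriv i (poly_prod q) x)"
  unfolding partial_deriv_poly_prod partial_deriv_def fun_eq_iff
  by (auto intro!: vector_derivative_at has_vector_derivative_diff has_vector_derivative_poly_prod)

lemma diff_deriv_poly_prod: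
  "diff_deriv i j (poly_prod q) =
     (\<lambda>x. poly_prod (q(i := pderiv (q i))) x - poly_prod (q(j := pderiv (q j))) x)"
  by (simp add: diff_deriv_def partial_deriv_poly_prod)

text \<open>Updates at distinct sites commute, so the two mixed derivatives coincide.\<close>

lemma diff_deriv_twice_poly_prod:
  assumes "i \<noteq> j"
  shows "(diff_deriv i j ^^ 2) (poly_prod q) x =
    poly_prod (q(i := pderiv (pderiv (q i)))) x
    - 2 * poly_prod (q(i := pderiv (q i), j := pderiv (q j))) x
    + poly_prod (q(j := pderiv (pderiv (q j)))) x"
  using assms
  by (simp add: numeral_2_eq_2 diff_deriv_poly_prod)
    (simp add: diff_deriv_def partial_deriv_diff_poly_prod partial_deriv_poly_prod
      fun_upd_twist[of j i])

section \<open>Duality for two sites\<close>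

lemma kummer_poly_pair_duality:
  fixes k l x y :: real and n m :: nat
  assumes "k > 0" "l > 0"
  defines "p \<equiv> \<lambda>n. poly (kummer_poly (2 * k) n) x"
    and "p' \<equiv> poly (pderiv (kummer_poly (2 * k) n)) x"
    and "p'' \<equiv> poly (pderiv (pderiv (kummer_poly (2 * k) n))) x"
    and "q \<equiv> \<lambda>m. poly (kummer_poly (2 * l) m) y"
    and "q' \<equiv> poly (pderiv (kummer_poly (2 * l) m)) y"
    and "q'' \<equiv> poly (pderiv (pderiv (kummer_poly (2 * l) m))) y"
  shows "real n * (2 * l + real m) * (p (n - 1) * q (Suc m) - p n * q m)
      + real m * (2 * k + real n) * (p (Suc n) * q (m - 1) - p n * q m) =
    x * y * (p'' * q m - 2 * (p' * q') + p n * q'')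
      - 2 * (l * x - k * y) * (p' * q m - p n * q')"
proof -
  have b: "2 * k > 0" "2 * l > 0" using assms by auto
  have P: "x * p' = real n * (p n - p (n - 1))"
      "x * p'' + 2 * k * p' = x * p' - real n * p n"
      "x * p n = (2 * k + 2 * real n) * p n - real n * p (n - 1) - (2 * k + real n) * p (Suc n)"
    unfolding p_def p'_def p''_def
    by (rule kummer_poly_lower kummer_poly_ode[OF b(1)] kummer_poly_recurrence[OF b(1)])+
  have Q: "y * q' = real m * (q m - q (m - 1))"
      "y * q'' + 2 * l * q' = y * q' - real m * q m"
      "y * q m = (2 * l + 2 * real m) * q m - real m * q (m - 1) - (2 * l + real m) * q (Suc m)"
    unfolding q_def q'_def q''_def
    by (rule kummer_poly_lower kummer_poly_ode[OF b(2)] kummer_poly_recurrence[OF b(2)])+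
  \<comment> \<open>Two of the four first-order terms complete the differential equations of
    \<open>p\<close> and \<open>q\<close>; the other two contain \<open>x * p'\<close> and
    \<open>y * q'\<close>, ready for the lowering relation.\<close>
  have "x * y * (p'' * q m - 2 * (p' * q') + p n * q'')
      - 2 * (l * x - k * y) * (p' * q m - p n * q') =
    (x * p'' + 2 * k * p') * (y * q m) + (x * p n) * (y * q'' + 2 * l * q')
      - 2 * (x * p') * (y * q') - 2 * l * (x * p') * q m - 2 * k * p n * (y * q')"
    by (simp add: algebra_simps)
  also have "\<dots> = (x * p' - real n * p n) * (y * q m) + (x * p n) * (y * q' - real m * q m)
      - 2 * (x * p') * (y * q') - 2 * l * (x * p') * q m - 2 * k * p n * (y * q')"
    unfolding P(2) Q(2) ..
  \<comment> \<open>The terms in \<open>p (n - 1) * q (m - 1)\<close> cancel: their coefficients are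
    \<open>n * m\<close> twice and \<open>- 2 * n * m\<close>.\<close>
  also have "\<dots> = real n * (2 * l + real m) * (p (n - 1) * q (Suc m) - p n * q m)
      + real m * (2 * k + real n) * (p (Suc n) * q (m - 1) - p n * q m)"
    unfolding P(1,3) Q(1,3) by (simp add: algebra_simps)
  finally show ?thesis by simp
qed

section \<open>From two sites to an edge of the full system\<close>

lemma move_nth:
  assumes "i \<noteq> j"
  shows "move i j n $ l = (if l = i then n $ i - 1 else if l = j then Suc (n $ j) else n $ l)"
  using assms by (auto simp: move_def axis_def)

text \<open>Meant for \<open>m = n\<close> and for both moves along the edge: the product over the
  other sites is shared, and the power of \<open>c\<close> sees only \<open>m $ i + m $ j\<close>,
  which an actual jump conserves.\<close>

lemma duality_fun_remove2:
  assumes "\<And>j. k $ j > 0" "c > 0" "i \<noteq> j" "\<And>l. l \<noteq> i \<Longrightarrow> l \<noteq> j \<Longrightarrow> m $ l = n $ l"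
  shows "duality_fun c k m x = complex_of_real (
    (c powr (- 1 / 2)) ^ (m $ i + m $ j) *
    (poly (kummer_poly (2 * k $ i) (m $ i)) (x $ i) * poly (kummer_poly (2 * k $ j) (m $ j)) (x $ j)) *
    (\<Prod>l\<in>UNIV - {i, j}. normalized_laguerre c (n $ l) (x $ l) (k $ l)))"
proof -
  have "(\<Prod>l\<in>UNIV - {i, j}. normalized_laguerre c (m $ l) (x $ l) (k $ l)) =
      (\<Prod>l\<in>UNIV - {i, j}. normalized_laguerre c (n $ l) (x $ l) (k $ l))"
    using assms(4) by (intro prod.cong) auto
  then show ?thesis
    unfolding duality_fun_def prod_remove2[OF assms(3)]
    using assms(1,2) by (simp add: normalized_laguerre_eq_kummer_poly power_add mult_ac)
qed

lemma duality_fun_edge: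
  fixes k x :: "real ^ 'N::finite" and n :: "nat ^ 'N"
  assumes k: "\<And>j. k $ j > 0" and c: "c > 0" and ij: "i \<noteq> j"
  defines "D \<equiv> duality_fun c k"
  shows "(real (n $ i) * (2 * k $ j + real (n $ j))) *\<^sub>R (D (move i j n) x - D n x)
      + (real (n $ j) * (2 * k $ i + real (n $ i))) *\<^sub>R (D (move j i n) x - D n x) =
    (x $ i * x $ j) *\<^sub>R (diff_deriv i j ^^ 2) (D n) x
      - (2 * (k $ j * x $ i - k $ i * x $ j)) *\<^sub>R diff_deriv i j (D n) x"
proof -
  define s where "s = c powr (- 1 / 2)"
  define P where "P = (\<lambda>a. poly (kummer_poly (2 * k $ i) a) (x $ i))"
  define Q where "Q = (\<lambda>a. poly (kummer_poly (2 * k $ j) a) (x $ j))"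
  define P1 where "P1 = poly (pderiv (kummer_poly (2 * k $ i) (n $ i))) (x $ i)"
  define P2 where "P2 = poly (pderiv (pderiv (kummer_poly (2 * k $ i) (n $ i)))) (x $ i)"
  define Q1 where "Q1 = poly (pderiv (kummer_poly (2 * k $ j) (n $ j))) (x $ j)"
  define Q2 where "Q2 = poly (pderiv (pderiv (kummer_poly (2 * k $ j) (n $ j)))) (x $ j)"
  define W where "W = s ^ (n $ i + n $ j) *
    (\<Prod>l\<in>UNIV - {i, j}. normalized_laguerre c (n $ l) (x $ l) (k $ l))"
  define q where "q = (\<lambda>l. smult (s ^ (n $ l)) (kummer_poly (2 * k $ l) (n $ l)))"
  have Dq: "D n = poly_prod q"
    unfolding D_def q_def s_def by (rule duality_fun_eq_poly_prod[OF k c])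
  \<comment> \<open>Here \<open>r\<close> stands for \<open>q\<close> with derivatives put in at
    \<open>i\<close> or \<open>j\<close>.\<close>
  have rest: "(\<Prod>l\<in>UNIV - {i, j}. poly (r l) (x $ l)) =
      (\<Prod>l\<in>UNIV - {i, j}. normalized_laguerre c (n $ l) (x $ l) (k $ l))"
    if "\<And>l. l \<noteq> i \<Longrightarrow> l \<noteq> j \<Longrightarrow> r l = q l" for r
    using that k c by (intro prod.cong) (auto simp: q_def s_def normalized_laguerre_eq_kummer_poly)
  note split = poly_prod_remove2[OF ij] W_def power_add q_def pderiv_smult ij ij[symmetric]
    P_def Q_def P1_def P2_def Q1_def Q2_def
  have D0: "D n x = complex_of_real (P (n $ i) * Q (n $ j) * W)"
    unfolding D_def
    by (subst duality_fun_remove2[OF k c ij, of n n]) (simp_all add: split s_def)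
  \<comment> \<open>The prefactor must stay: for \<open>n $ i = 0\<close> the truncated move adds a
    particle and \<open>W\<close> would carry the wrong power of \<open>s\<close>, but then both
    sides are 0.\<close>
  have Dij: "real (n $ i) *\<^sub>R D (move i j n) x =
      real (n $ i) *\<^sub>R complex_of_real (P (n $ i - 1) * Q (Suc (n $ j)) * W)"
  proof (cases "n $ i")
    case (Suc a)
    then show ?thesis
      unfolding D_def
      by (subst duality_fun_remove2[OF k c ij, of _ n])
        (simp_all add: move_nth[OF ij] split s_def)
  qed simp
  have Dji: "real (n $ j) *\<^sub>R D (move j i n) x =
      real (n $ j) *\<^sub>R complex_of_real (P (Suc (n $ i)) * Q (n $ j - 1) * W)"
  proof (cases "n $ j")
    case (Suc a)
    then show ?thesis
      unfolding D_def
      by (subst duality_fun_remove2[OF k c ij, of _ n])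
        (simp_all add: move_nth[OF ij[symmetric]] split s_def)
  qed simp
  have D1: "diff_deriv i j (D n) x =
      complex_of_real (P1 * Q (n $ j) * W) - complex_of_real (P (n $ i) * Q1 * W)"
    unfolding Dq diff_deriv_poly_prod
    by (simp add: poly_prod_remove2[OF ij] rest) (simp add: split)
  have D2: "(diff_deriv i j ^^ 2) (D n) x = complex_of_real (P2 * Q (n $ j) * W)
      - 2 * complex_of_real (P1 * Q1 * W) + complex_of_real (P (n $ i) * Q2 * W)"
    unfolding Dq diff_deriv_twice_poly_prod[OF ij]
    by (simp add: poly_prod_remove2[OF ij] rest) (simp add: split)
  \<comment> \<open>The occupation numbers are moved onto the \<open>D\<close> terms so that
    \<open>Dij\<close> and \<open>Dji\<close> apply.\<close>
  have "(real (n $ i) * (2 * k $ j + real (n $ j))) *\<^sub>R (D (move i j n) x - D n x)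
      + (real (n $ j) * (2 * k $ i + real (n $ i))) *\<^sub>R (D (move j i n) x - D n x) =
    (2 * k $ j + real (n $ j)) *\<^sub>R (real (n $ i) *\<^sub>R D (move i j n) x - real (n $ i) *\<^sub>R D n x)
      + (2 * k $ i + real (n $ i)) *\<^sub>R (real (n $ j) *\<^sub>R D (move j i n) x - real (n $ j) *\<^sub>R D n x)"
    by (simp add: algebra_simps)
  also have "\<dots> = complex_of_real (W *
     (real (n $ i) * (2 * k $ j + real (n $ j)) * (P (n $ i - 1) * Q (Suc (n $ j)) - P (n $ i) * Q (n $ j))
      + real (n $ j) * (2 * k $ i + real (n $ i)) * (P (Suc (n $ i)) * Q (n $ j - 1) - P (n $ i) * Q (n $ j))))"
    unfolding Dij Dji D0 by (simp add: scaleR_conv_of_real algebra_simps)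
  also have "\<dots> = complex_of_real (W *
     (x $ i * x $ j * (P2 * Q (n $ j) - 2 * (P1 * Q1) + P (n $ i) * Q2)
      - 2 * (k $ j * x $ i - k $ i * x $ j) * (P1 * Q (n $ j) - P (n $ i) * Q1)))"
    unfolding P_def Q_def P1_def P2_def Q1_def Q2_def
    by (subst kummer_poly_pair_duality[OF k k]) (rule refl)
  also have "\<dots> = (x $ i * x $ j) *\<^sub>R (diff_deriv i j ^^ 2) (D n) x
      - (2 * (k $ j * x $ i - k $ i * x $ j)) *\<^sub>R diff_deriv i j (D n) x"
    unfolding D1 D2 by (simp add: scaleR_conv_of_real algebra_simps)
  finally show ?thesis .
qed

theorem theorem4p15:
  fixes k :: "real ^ 'N::{finite,linorder}" and c :: real
    and n :: "nat ^ 'N::{finite,linorder}" and x :: "real ^ 'N::{finite,linorder}"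
  assumes "\<And>j. k $ j > 0"
    and "0 < c" and "c < 1"
    and "\<And>j. x $ j > 0"
  shows "SIP_gen k (\<lambda>m. duality_fun c k m x) n = BEP_gen k (\<lambda>y. duality_fun c k n y) x"
  unfolding SIP_gen_def BEP_gen_def
  \<comment> \<open>Both sums run over \<open>i < j\<close>, hence over distinct sites, and agree
    term by term.\<close>
  using duality_fun_edge[OF assms(1,2)] by (intro sum.cong) auto

end
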